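(* Let $J\ge 3$. The family of reference models $\{(\text{reference},F,Z);\ F\in\mathfrak{F},\ Z\in\mathfrak{Z}\}$ is stable under each of the $(J-1)!$ permutations $\sigma$ of $\{1,\dots,J\}$ that fix the reference category (that is, $\sigma(J)=J$).
   Context: Setting. Let $J\ge 3$ (number of categories), $p\ge 1$, and let $\mathcal{X}\subseteq\mathbb{R}^p$ be the nonempty set of values of the explanatory vector $x$. Let $\mathcal{M}=\{\pi\in\,]0,1[^{J-1} : \sum_{j=1}^{J-1}\pi_j<1\}$; for $\pi\in\mathcal{M}$ put $\pi_J=1-\sum_{j=1}^{J-1}\pi_j$ ($\pi_j$ is the probability of category $j$). Ratio. The reference ratio $r:\mathcal{M}\to\,]0,1[^{J-1}$ is $r_j(\pi)=\pi_j/(\pi_j+\pi_J)$, $j=1,\dots,J-1$; it is a bijection onto $]0,1[^{J-1}$. The reference category is $J$. Cdfs. $\mathfrak{F}$ is the set of continuous cumulative distribution functions $F$ on $\mathbb{R}$ that are strictly increasing on the open interval $I_F=\{w: 0<F(w)<1\}$, so that $F$ maps $I_F$ bijectively onto $]0,1[$. Design matrices. The complete design matrix $Z_c(x)$ is the $(J-1)\times(J-1)(1+p)$ matrix with $Z_c(x)\beta=(\alpha_j+x^t\delta_j)_{j=1,\dots,J-1}$ for $\beta=(\alpha_1,\dots,\alpha_{J-1},\delta_1^t,\dots,\delta_{J-1}^t)^t$, $\alpha_j\in\mathbb{R}$, $\delta_j\in\mathbb{R}^p$. The set $\mathfrak{Z}$ of design matrices consists of all matrix functions $Z:x\mapsto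 Z_c(x)C$, where $C$ is a constant real matrix of full column rank with $q$ columns, $J-1+p\le q\le (J-1)(1+p)$. Models. A model $(r,F,Z)$, with $Z$ having $q$ columns, has as parameter space the set of $\beta\in\mathbb{R}^q$ such that for all $x\in\mathcal{X}$, $\eta=Z(x)\beta$ satisfies $\eta\in I_F^{J-1}$ and $(F(\eta_1),\dots,F(\eta_{J-1}))\in r(\mathcal{M})$. For such $\beta$ and $x\in\mathcal{X}$, it defines the unique $\pi=\pi(x;\beta)\in\mathcal{M}$ with $r(\pi)=(F(\eta_1),\dots,F(\eta_{J-1}))^t$, $\eta=Z(x)\beta$. Permuted models. For a permutation $\sigma$ of $\{1,\dots,J\}$ and $\pi\in\mathcal{M}$, let $\pi_\sigma=(\pi_{\sigma(1)},\dots,\pi_{\sigma(J-1)})\in\mathcal{M}$. The permuted model $(r,F,Z)_\sigma$ has the same parameter space as $(r,F,Z)$ and defines $\pi=\pi(x;\beta)\in\mathcal{M}$ by $r(\pi_\sigma)=(F(\eta_1),\dots,F(\eta_{J-1}))^t$, $\eta=Z(x)\beta$. Two (possibly permuted) models are equal if they have the same parameter space and give the same $\pi(x;\beta)$ for all $x\in\mathcal{X}$ and all $\beta$ in it. A family of models $\mathfrak{M}$ is stable under $\sigma$ if $\sigma(\mathfrak{M})=\mathfrak{M}$, where $\sigma(\mathfrak{M})=\{(r,F,Z)_\sigma : (r,F,Z)\in\mathfrak{M}\}$ and equal models are identified (i.e. every model of each of the two sets is equal to some model of the other). *)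

theory Defs
  imports "HOL-Probability.Distribution_Functions" "Jordan_Normal_Form.DL_Rank"
begin

unbundle no vec_syntax

(* Categories are numbered 1..J, while vectors are indexed from 0:
   the probability of category j < J is entry j - 1 of pi, a vector of length J - 1. *)

definition prob_vectors :: "nat \<Rightarrow> real vec set" where
  "prob_vectors J = {\<pi> \<in> carrier_vec (J - 1).
     (\<forall>i < J - 1. 0 < \<pi> $ i \<and> \<pi> $ i < 1) \<and> (\<Sum>i < J - 1. \<pi> $ i) < 1}"

definition cat_prob :: "nat \<Rightarrow> real vec \<Rightarrow> nat \<Rightarrow> real" where
  "cat_prob J \<pi> j = (if j = J then 1 - (\<Sum>i < J - 1. \<pi> $ i) else \<pi> $ (j - 1))"

definition permute_probs :: "nat \<Rightarrow> (nat \<Rightarrow> nat) \<Rightarrow> real vec \<Rightarrow> real vec" where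
  "permute_probs J \<sigma> \<pi> = Matrix.vec (J - 1) (\<lambda>i. cat_prob J \<pi> (\<sigma> (i + 1)))"

definition reference_ratio :: "nat \<Rightarrow> real vec \<Rightarrow> real vec" where
  "reference_ratio J \<pi> = Matrix.vec (J - 1)
     (\<lambda>i. cat_prob J \<pi> (i + 1) / (cat_prob J \<pi> (i + 1) + cat_prob J \<pi> J))"

definition cdf_interval :: "(real \<Rightarrow> real) \<Rightarrow> real set" where
  "cdf_interval F = {w. 0 < F w \<and> F w < 1}"

definition link_cdfs :: "(real \<Rightarrow> real) set" where
  "link_cdfs = {F. (\<exists>M. real_distribution M \<and> F = cdf M) \<and>
     continuous_on UNIV F \<and> strict_mono_on (cdf_interval F) F}"

(* The parameter is beta = (alpha_1, ..., alpha_{J-1}, delta_1, ..., delta_{J-1}), so entry l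
   of the block delta_{i+1} has index (J - 1) + i * p + l; see complete_design_mult_vec below. *)
definition complete_design :: "nat \<Rightarrow> nat \<Rightarrow> real vec \<Rightarrow> real mat" where
  "complete_design J p x = Matrix.mat (J - 1) ((J - 1) * (1 + p))
     (\<lambda>(i, k). if k < J - 1 then (if k = i then 1 else 0)
               else if (k - (J - 1)) div p = i then x $ ((k - (J - 1)) mod p) else 0)"

definition designs :: "nat \<Rightarrow> nat \<Rightarrow> (real vec \<Rightarrow> real mat) set" where
  "designs J p = {Z. \<exists>q C. J - 1 + p \<le> q \<and> q \<le> (J - 1) * (1 + p) \<and>
     C \<in> carrier_mat ((J - 1) * (1 + p)) q \<and> vec_space.rank ((J - 1) * (1 + p)) C = q \<and>
     Z = (\<lambda>x. complete_design J p x * C)}"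

(* A specification is a triple (r, F, Z); a model is what it defines, namely a parameter
   space and the map from x and beta to pi(x; beta). *)

type_synonym spec = "(real vec \<Rightarrow> real vec) \<times> (real \<Rightarrow> real) \<times> (real vec \<Rightarrow> real mat)"

record model =
  param_space :: "real vec set"
  probs :: "real vec \<Rightarrow> real vec \<Rightarrow> real vec"

(* The number q of columns of Z is read off as dim_col (Z x), which does not depend on x
   when Z is a design. *)
definition parameters :: "nat \<Rightarrow> real vec set \<Rightarrow> spec \<Rightarrow> real vec set" where
  "parameters J X = (\<lambda>(r, F, Z). {\<beta>. \<forall>x \<in> X. \<beta> \<in> carrier_vec (dim_col (Z x)) \<and>
     (\<forall>i < J - 1. (Z x *\<^sub>v \<beta>) $ i \<in> cdf_interval F) \<and>
     map_vec F (Z x *\<^sub>v \<beta>) \<in> r ` prob_vectors J})"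

definition model_of :: "nat \<Rightarrow> real vec set \<Rightarrow> spec \<Rightarrow> model" where
  "model_of J X = (\<lambda>(r, F, Z).
     \<lparr> param_space = parameters J X (r, F, Z),
       probs = (\<lambda>x \<beta>. THE \<pi>. \<pi> \<in> prob_vectors J \<and> r \<pi> = map_vec F (Z x *\<^sub>v \<beta>)) \<rparr>)"

definition permuted_model_of :: "nat \<Rightarrow> real vec set \<Rightarrow> (nat \<Rightarrow> nat) \<Rightarrow> spec \<Rightarrow> model" where
  "permuted_model_of J X \<sigma> = (\<lambda>(r, F, Z).
     \<lparr> param_space = parameters J X (r, F, Z),
       probs = (\<lambda>x \<beta>. THE \<pi>. \<pi> \<in> prob_vectors J \<and>
                 r (permute_probs J \<sigma> \<pi>) = map_vec F (Z x *\<^sub>v \<beta>)) \<rparr>)"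

definition models_equal :: "real vec set \<Rightarrow> model \<Rightarrow> model \<Rightarrow> bool" where
  "models_equal X m m' \<longleftrightarrow> param_space m = param_space m' \<and>
     (\<forall>x \<in> X. \<forall>\<beta> \<in> param_space m. probs m x \<beta> = probs m' x \<beta>)"

definition stable_under :: "nat \<Rightarrow> real vec set \<Rightarrow> (nat \<Rightarrow> nat) \<Rightarrow> spec set \<Rightarrow> bool" where
  "stable_under J X \<sigma> \<MM> \<longleftrightarrow>
     (\<forall>s \<in> \<MM>. \<exists>t \<in> \<MM>. models_equal X (permuted_model_of J X \<sigma> s) (model_of J X t)) \<and>
     (\<forall>t \<in> \<MM>. \<exists>s \<in> \<MM>. models_equal X (model_of J X t) (permuted_model_of J X \<sigma> s))"

definition reference_models :: "nat \<Rightarrow> nat \<Rightarrow> spec set" where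
  "reference_models J p = {(reference_ratio J, F, Z) | F Z. F \<in> link_cdfs \<and> Z \<in> designs J p}"

lemma complete_design_mult_vec:
  assumes "\<beta> \<in> carrier_vec ((J - 1) * (1 + p))" and "i < J - 1"
  shows "(complete_design J p x *\<^sub>v \<beta>) $ i = \<beta> $ i + (\<Sum>l<p. x $ l * \<beta> $ ((J - 1) + i * p + l))"
proof -
  define n where "n = J - 1"
  define g where "g k = (if k < n then (if k = i then 1 else 0)
     else if (k - n) div p = i then x $ ((k - n) mod p) else 0) * \<beta> $ k" for k
  have i: "i < n" using assms n_def by simp
  have "(complete_design J p x *\<^sub>v \<beta>) $ i = (\<Sum>k\<in>{0..<n * (1 + p)}. g k)"
    using assms unfolding complete_design_def g_def n_def
    by (simp add: scalar_prod_def)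
  also have "\<dots> = (\<Sum>k\<in>{0..<n}. g k) + (\<Sum>k\<in>{n..<n * (1 + p)}. g k)"
    by (rule sum.atLeastLessThan_concat[symmetric]) auto
  also have "(\<Sum>k\<in>{0..<n}. g k) = (\<Sum>k\<in>{0..<n}. if k = i then \<beta> $ k else 0)"
    by (rule sum.cong) (auto simp: g_def)
  also have "\<dots> = \<beta> $ i" using i by simp
  also have "(\<Sum>k\<in>{n..<n * (1 + p)}. g k) = (\<Sum>l<p. x $ l * \<beta> $ (n + i * p + l))"
  proof (rule sum.mono_neutral_cong_right[THEN trans])
    let ?B = "(\<lambda>l. n + i * p + l) ` {..<p}"
    show "finite {n..<n * (1 + p)}" by simp
    have "(i + 1) * p \<le> n * p" using i by (intro mult_right_mono) auto
    then show "?B \<subseteq> {n..<n * (1 + p)}" by (auto simp: algebra_simps)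
    show "\<forall>k\<in>{n..<n * (1 + p)} - ?B. g k = 0"
    proof
      fix k assume k: "k \<in> {n..<n * (1 + p)} - ?B"
      have "(k - n) div p \<noteq> i"
      proof
        assume *: "(k - n) div p = i"
        have "p > 0" using k by (cases p) auto
        then have "(k - n) mod p < p" by simp
        moreover have "k = n + i * p + (k - n) mod p"
          using k div_mult_mod_eq[of "k - n" p] * by auto
        ultimately show False using k by blast
      qed
      then show "g k = 0" using k by (auto simp: g_def)
    qed
    show "g k = g k" for k by simp
    show "sum g ?B = (\<Sum>l<p. x $ l * \<beta> $ (n + i * p + l))"
      by (subst sum.reindex) (auto simp: inj_on_def g_def intro!: sum.cong)
  qed
  finally show ?thesis unfolding n_def .
qed

end

theory Submission
  imports Defs
begin

text \<open>A permutation fixing the reference category permutes the entries of the reference ratio,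
  so permuting the model amounts to permuting the rows of the design. In a design
  \<open>Z\<^sub>c(x) C\<close> this can be absorbed into \<open>C\<close>, by permuting its intercept rows and its blocks of
  slope rows in the same way, and permuting rows preserves full column rank.\<close>

section \<open>Full column rank as a trivial kernel\<close>

text \<open>\<open>rank\<close> is defined through the set of columns, in which a repeated column
  counts once. Both directions therefore first show that the columns are distinct; then a nonzero
  kernel vector is the same thing as a linear dependence between them.\<close>

lemma (in vec_space) full_column_rank_iff:
  assumes A: "A \<in> carrier_mat n nc"
  shows "rank A = nc \<longleftrightarrow> (\<forall>v \<in> carrier_vec nc. A *\<^sub>v v = 0\<^sub>v n \<longrightarrow> v = 0\<^sub>v nc)"
proof
  assume r: "rank A = nc"
  have "distinct (cols A)"
  proof -
    \<comment> \<open>A maximal independent set of columns has \<open>rank A = nc\<close> elements,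
      so the column set has at least \<open>nc\<close> of them, while the list of columns has length
      \<open>nc\<close>: no repetition is possible.\<close>
    obtain S where S: "maximal S (\<lambda>T. T \<subseteq> set (cols A) \<and> lin_indpt T)"
      using maximal_exists_superset[of "set (cols A)" "\<lambda>T. T \<subseteq> set (cols A) \<and> lin_indpt T" "{}"]
      by (metis List.finite_set empty_iff empty_subsetI finite_lin_indpt2 finite.emptyI)
    then have "nc \<le> card (set (cols A))"
      using rank_card_indpt[OF A S] r by (metis List.finite_set card_mono maximal_def)
    moreover have "length (cols A) = nc" using A by simp
    ultimately show ?thesis by (metis card_distinct card_length le_antisym)
  qed
  with full_rank_lin_indpt[OF A r] lin_depI[OF A]
  show "\<forall>v \<in> carrier_vec nc. A *\<^sub>v v = 0\<^sub>v n \<longrightarrow> v = 0\<^sub>v nc" by blast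
next
  assume inj: "\<forall>v \<in> carrier_vec nc. A *\<^sub>v v = 0\<^sub>v n \<longrightarrow> v = 0\<^sub>v nc"
  have "distinct (cols A)"
  proof (rule ccontr)
    assume "\<not> distinct (cols A)"
    then obtain i j where ij: "i < nc" "j < nc" "i \<noteq> j" "col A i = col A j"
      using A unfolding distinct_conv_nth by auto
    \<comment> \<open>Two equal columns give a nonzero kernel vector, the difference of the two unit
      vectors.\<close>
    define v where "v = unit_vec nc i - (unit_vec nc j :: 'a vec)"
    have "A *\<^sub>v v = A *\<^sub>v unit_vec nc i - A *\<^sub>v unit_vec nc j"
      unfolding v_def by (rule mult_minus_distrib_mat_vec[OF A]) auto
    also have "\<dots> = 0\<^sub>v n" using A ij by (intro eq_vecI) (auto simp: row_def col_def vec_eq_iff)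
    finally have "v = 0\<^sub>v nc" using inj by (auto simp: v_def)
    then have "v $ i = 0" using ij by simp
    then show False using ij by (simp add: v_def)
  qed
  then show "rank A = nc" using lin_indpt_full_rank[OF A] lin_depE[OF A] inj by metis
qed

section \<open>Permuting the entries of vectors and the rows of matrices\<close>

text \<open>Entries are read through \<tau>, the convention of \<open>permute_probs\<close>;
  composition therefore reverses the order, as \<open>permute_vec_comp\<close> records.\<close>

definition permute_vec :: "(nat \<Rightarrow> nat) \<Rightarrow> 'a vec \<Rightarrow> 'a vec" where
  "permute_vec \<tau> v = Matrix.vec (dim_vec v) (\<lambda>i. v $ \<tau> i)"

definition permute_rows :: "(nat \<Rightarrow> nat) \<Rightarrow> 'a mat \<Rightarrow> 'a mat" where
  "permute_rows \<tau> A = Matrix.mat (dim_row A) (dim_col A) (\<lambda>(i, j). A $$ (\<tau> i, j))"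

lemma permutes_lessThan_less: "\<tau> permutes {..<n} \<Longrightarrow> i < n \<Longrightarrow> \<tau> i < n"
  using permutes_in_image[of \<tau> "{..<n}" i] by simp

lemma permute_vec_carrier [simp]: "permute_vec \<tau> v \<in> carrier_vec n \<longleftrightarrow> v \<in> carrier_vec n"
  unfolding carrier_dim_vec permute_vec_def by (simp only: dim_vec)

lemma permute_vec_comp:
  assumes "\<tau> permutes {..<n}" and "v \<in> carrier_vec n"
  shows "permute_vec \<tau> (permute_vec \<rho> v) = permute_vec (\<lambda>i. \<rho> (\<tau> i)) v"
  using assms by (auto simp: permute_vec_def permutes_lessThan_less)

lemma permute_vec_id: "permute_vec (\<lambda>i. i) v = v"
  by (auto simp: permute_vec_def)

lemma permute_vec_inv:
  assumes "\<tau> permutes {..<n}" and "v \<in> carrier_vec n"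
  shows "permute_vec \<tau> (permute_vec (inv_into UNIV \<tau>) v) = v"
    and "permute_vec (inv_into UNIV \<tau>) (permute_vec \<tau> v) = v"
  using assms permutes_inv[OF assms(1)] permutes_inverses[OF assms(1)]
  by (auto simp: permute_vec_comp permute_vec_id)

lemma permute_vec_eq_iff:
  assumes "\<tau> permutes {..<n}" and "v \<in> carrier_vec n" and "w \<in> carrier_vec n"
  shows "permute_vec \<tau> v = permute_vec \<tau> w \<longleftrightarrow> v = w"
  using permute_vec_inv(2)[OF assms(1)] assms by metis

lemma map_vec_permute_vec:
  assumes "\<tau> permutes {..<n}" and "v \<in> carrier_vec n"
  shows "map_vec f (permute_vec \<tau> v) = permute_vec \<tau> (map_vec f v)"
  using assms by (auto simp: permute_vec_def permutes_lessThan_less)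

lemma permute_vec_all_iff:
  assumes "\<tau> permutes {..<n}" and "v \<in> carrier_vec n"
  shows "(\<forall>i<n. P (permute_vec \<tau> v $ i)) \<longleftrightarrow> (\<forall>i<n. P (v $ i))"
proof
  assume *: "\<forall>i<n. P (permute_vec \<tau> v $ i)"
  show "\<forall>i<n. P (v $ i)"
  proof (intro allI impI)
    fix i assume "i < n"
    then have "inv_into UNIV \<tau> i < n" using permutes_inv[OF assms(1)] permutes_lessThan_less by blast
    then show "P (v $ i)"
      using * assms permutes_inverses(1)[OF assms(1)] by (force simp: permute_vec_def)
  qed
qed (use assms in \<open>auto simp: permute_vec_def permutes_lessThan_less\<close>)

lemma sum_permute_vec:
  assumes "\<tau> permutes {..<n}" and "v \<in> carrier_vec n"
  shows "(\<Sum>i<n. permute_vec \<tau> v $ i) = (\<Sum>i<n. v $ i)"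
proof -
  have "(\<Sum>i<n. permute_vec \<tau> v $ i) = (\<Sum>i<n. v $ \<tau> i)"
    using assms by (intro sum.cong) (auto simp: permute_vec_def)
  also have "\<dots> = (\<Sum>i<n. v $ i)"
    using sum.permute[OF assms(1), of "\<lambda>i. v $ i"] by (simp add: o_def)
  finally show ?thesis .
qed

lemma dim_permute_rows [simp]:
  "dim_row (permute_rows \<tau> A) = dim_row A" "dim_col (permute_rows \<tau> A) = dim_col A"
  by (auto simp: permute_rows_def)

lemma permute_rows_mult_vec:
  assumes "\<tau> permutes {..<dim_row A}" and "dim_col A = dim_vec v"
  shows "permute_rows \<tau> A *\<^sub>v v = permute_vec \<tau> (A *\<^sub>v v)"
  using assms
  by (auto simp: permute_rows_def permute_vec_def permutes_lessThan_less scalar_prod_def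
      intro!: eq_vecI sum.cong)

lemma permute_rows_inv:
  assumes "\<tau> permutes {..<dim_row A}"
  shows "permute_rows \<tau> (permute_rows (inv_into UNIV \<tau>) A) = A"
  using assms permutes_inverses(2)[OF assms]
  by (auto simp: permute_rows_def permutes_lessThan_less)

text \<open>Permuting entries is injective and fixes the zero vector, so every kernel vector of the
  permuted matrix is a kernel vector of \<open>C\<close>, hence zero.\<close>

lemma full_column_rank_permute_rows:
  fixes C :: "'a :: field mat"
  assumes C: "C \<in> carrier_mat n q" and \<kappa>: "\<kappa> permutes {..<n}" and r: "vec_space.rank n C = q"
  shows "vec_space.rank n (permute_rows \<kappa> C) = q"
proof -
  have C': "permute_rows \<kappa> C \<in> carrier_mat n q" using C by auto
  show ?thesis
    unfolding vec_space.full_column_rank_iff[OF C']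
  proof (intro ballI impI)
    fix v assume v: "v \<in> carrier_vec q" and "permute_rows \<kappa> C *\<^sub>v v = 0\<^sub>v n"
    then have "permute_vec \<kappa> (C *\<^sub>v v) = 0\<^sub>v n" using C \<kappa> permute_rows_mult_vec[of \<kappa> C v] by auto
    also have "0\<^sub>v n = permute_vec \<kappa> (0\<^sub>v n :: 'a vec)"
      using \<kappa> by (auto simp: permute_vec_def permutes_lessThan_less)
    finally have "permute_vec \<kappa> (C *\<^sub>v v) = permute_vec \<kappa> (0\<^sub>v n)" .
    moreover have "C *\<^sub>v v \<in> carrier_vec n" using C v by simp
    ultimately have "C *\<^sub>v v = 0\<^sub>v n" using permute_vec_eq_iff[OF \<kappa>] zero_carrier_vec by blast
    then show "v = 0\<^sub>v q" using r v unfolding vec_space.full_column_rank_iff[OF C] by blast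
  qed
qed

section \<open>Permuting the rows of a design\<close>

text \<open>The action on the parameter \<open>\<beta> = (\<alpha>, \<delta>)\<close>: the first \<open>n\<close> indices are permuted by \<open>\<tau>\<close>,
  and so are the \<open>n\<close> blocks of length \<open>p\<close> that follow.\<close>

definition block_perm :: "nat \<Rightarrow> nat \<Rightarrow> (nat \<Rightarrow> nat) \<Rightarrow> nat \<Rightarrow> nat" where
  "block_perm n p \<tau> k = (if k < n then \<tau> k
     else if k < n * (1 + p) then n + \<tau> ((k - n) div p) * p + (k - n) mod p else k)"

lemma block_index_less: "i < n \<Longrightarrow> l < p \<Longrightarrow> n + i * p + l < n * (1 + p)" for n p :: nat
proof -
  assume "i < n" "l < p"
  then have "i * p + l < (i + 1) * p" by simp
  also have "\<dots> \<le> n * p" using \<open>i < n\<close> by (intro mult_right_mono) auto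
  finally show ?thesis by (simp add: algebra_simps)
qed

lemma block_perm_block:
  "i < n \<Longrightarrow> l < p \<Longrightarrow> block_perm n p \<tau> (n + i * p + l) = n + \<tau> i * p + l"
  using block_index_less[of i n l p] by (auto simp: block_perm_def add.assoc)

text \<open>Division with remainder by \<open>p\<close> decodes an index beyond the intercepts into
  the number of its slope block and the position within it. An index in that range forces
  \<open>p\<close> to be positive, which bounds the remainder.\<close>

lemma block_index_cases:
  fixes k n p :: nat
  assumes "k < n * (1 + p)"
  obtains "k < n" | i l where "i < n" "l < p" "k = n + i * p + l"
proof (cases "k < n")
  case False
  then have kn: "k - n < n * p" using assms by (simp add: algebra_simps)
  then have "0 < p" by (cases p) auto
  moreover have "k = n + (k - n) div p * p + (k - n) mod p" using False by simp
  moreover have "(k - n) div p < n" using kn by (simp add: less_mult_imp_div_less)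
  ultimately show ?thesis using that(2) by (metis mod_less_divisor)
qed (use that in blast)

lemma block_perm_permutes:
  assumes "\<tau> permutes {..<n}"
  shows "block_perm n p \<tau> permutes {..<n * (1 + p)}"
proof -
  \<comment> \<open>This bound and the cancellation below are stated for arbitrary permutations
    because each is applied both to \<tau> and to its inverse, whose block permutation serves as the
    inverse map.\<close>
  have into: "block_perm n p \<rho> k < n * (1 + p)"
    if "\<rho> permutes {..<n}" "k < n * (1 + p)" for \<rho> k
    using that(2)
  proof (cases rule: block_index_cases)
    case 1
    then show ?thesis using permutes_lessThan_less[OF that(1) 1]
      by (simp add: block_perm_def)
  next
    case (2 i l)
    then show ?thesis
      using block_index_less[OF permutes_lessThan_less[OF that(1)], of i l p]
      by (simp only: block_perm_block)
  qed
  have canc: "block_perm n p \<rho> (block_perm n p \<rho>' k) = k"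
    if "\<rho>' permutes {..<n}" "\<And>i. \<rho> (\<rho>' i) = i" "k < n * (1 + p)" for \<rho> \<rho>' k
    using that(3)
  proof (cases rule: block_index_cases)
    case 1
    then show ?thesis using permutes_lessThan_less[OF that(1) 1] that(2)
      by (simp add: block_perm_def)
  next
    case (2 i l)
    then show ?thesis using permutes_lessThan_less[OF that(1)] that(2)
      by (simp add: block_perm_block)
  qed
  note inv = permutes_inv[OF assms] permutes_inverses[OF assms]
  have "bij_betw (block_perm n p \<tau>) {..<n * (1 + p)} {..<n * (1 + p)}"
    by (rule bij_betw_byWitness[where f' = "block_perm n p (inv_into UNIV \<tau>)"])
      (use assms inv into canc in \<open>auto simp del: mult_Suc_right\<close>)
  \<comment> \<open>\<open>permutes\<close> also asks for the identity outside the set, which is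
    what the last case of \<open>block_perm\<close> provides.\<close>
  then show ?thesis
    by (rule bij_imp_permutes) (auto simp: block_perm_def)
qed

text \<open>Row \<open>i\<close> of the product is intercept row \<open>i\<close> of
  \<open>C\<close> plus the combination, with coefficients \<open>x $ l\<close>, of the rows in
  slope block \<open>i\<close>. Reading intercepts and blocks of \<open>C\<close> through \<tau>
  thus reads the rows of the product through \<tau>.\<close>

lemma complete_design_permute_rows:
  assumes \<tau>: "\<tau> permutes {..<J - 1}" and C: "C \<in> carrier_mat ((J - 1) * (1 + p)) q"
  shows "complete_design J p x * permute_rows (block_perm (J - 1) p \<tau>) C =
    permute_rows \<tau> (complete_design J p x * C)"
proof (rule eq_matI)
  define n where "n = J - 1"
  define N where "N = n * (1 + p)"
  define \<kappa> where "\<kappa> = block_perm n p \<tau>"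
  note defs = n_def[symmetric] N_def[symmetric] \<kappa>_def[symmetric]
  have \<kappa>: "\<kappa> permutes {..<N}"
    unfolding \<kappa>_def N_def n_def by (rule block_perm_permutes[OF \<tau>])
  have D: "complete_design J p x \<in> carrier_mat n N"
    by (simp add: complete_design_def N_def n_def)
  have C': "C \<in> carrier_mat N q" using C by (simp only: defs)
  fix i j
  assume "i < dim_row (permute_rows \<tau> (complete_design J p x * C))"
    "j < dim_col (permute_rows \<tau> (complete_design J p x * C))"
  then have i: "i < n" and j: "j < q" using D C' by auto
  have \<tau>i: "\<tau> i < n" using \<tau> i permutes_lessThan_less n_def by blast
  \<comment> \<open>A column of a product is the matrix applied to a column, so
    \<open>complete_design_mult_vec\<close> gives every entry. It is used for \<open>C\<close> in
    row \<open>\<tau> i\<close> and for the permuted \<open>C\<close> in row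
    \<open>i\<close>.\<close>
  have entry: "(complete_design J p x * B) $$ (k, j) =
      B $$ (k, j) + (\<Sum>l<p. x $ l * B $$ (n + k * p + l, j))"
    if B: "B \<in> carrier_mat N q" and k: "k < n" for B :: "real mat" and k
  proof -
    have idx: "n + k * p + l < N" if "l < p" for l
      unfolding N_def by (rule block_index_less[OF k that])
    have "k < N" using k by (simp add: N_def)
    have "(complete_design J p x * B) $$ (k, j) = (complete_design J p x *\<^sub>v col B j) $ k"
      using D B j k by simp
    also have "\<dots> = col B j $ k + (\<Sum>l<p. x $ l * col B j $ (n + k * p + l))"
    proof -
      have "col B j \<in> carrier_vec N" using B by auto
      then show ?thesis
        using complete_design_mult_vec[of "col B j" J p k x] k unfolding N_def n_def by blast
    qed
    also have "\<dots> = B $$ (k, j) + (\<Sum>l<p. x $ l * B $$ (n + k * p + l, j))"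
      using B j \<open>k < N\<close> idx by (auto intro!: arg_cong2[where f = "(+)"] sum.cong)
    finally show ?thesis .
  qed
  have "(complete_design J p x * permute_rows \<kappa> C) $$ (i, j) =
      C $$ (\<tau> i, j) + (\<Sum>l<p. x $ l * C $$ (n + \<tau> i * p + l, j))"
  proof -
    have "i < N" using i by (simp add: N_def)
    moreover have "\<kappa> i = \<tau> i" using i by (simp add: \<kappa>_def block_perm_def)
    moreover have "permute_rows \<kappa> C $$ (n + i * p + l, j) = C $$ (n + \<tau> i * p + l, j)"
      if "l < p" for l
      using block_index_less[OF i that, folded N_def]
        block_perm_block[OF i that, of \<tau>, folded \<kappa>_def] C' j
      by (simp add: permute_rows_def)
    ultimately show ?thesis
      using entry[of "permute_rows \<kappa> C" i] C' i j by (auto simp: permute_rows_def)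
  qed
  also have "\<dots> = (complete_design J p x * C) $$ (\<tau> i, j)"
    using entry[OF C' \<tau>i] by simp
  also have "\<dots> = permute_rows \<tau> (complete_design J p x * C) $$ (i, j)"
    using D C' i j by (simp add: permute_rows_def)
  finally show "(complete_design J p x * permute_rows (block_perm (J - 1) p \<tau>) C) $$ (i, j) =
      permute_rows \<tau> (complete_design J p x * C) $$ (i, j)"
    by (simp only: defs)
qed auto

lemma designs_dim_row: "Z \<in> designs J p \<Longrightarrow> dim_row (Z x) = J - 1"
  by (auto simp: designs_def complete_design_def)

lemma designs_permute_rows:
  assumes \<tau>: "\<tau> permutes {..<J - 1}" and Z: "Z \<in> designs J p"
  shows "(\<lambda>x. permute_rows \<tau> (Z x)) \<in> designs J p"
proof -
  let ?N = "(J - 1) * (1 + p)" and ?\<kappa> = "block_perm (J - 1) p \<tau>"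
  obtain q C where q: "J - 1 + p \<le> q" "q \<le> ?N" and C: "C \<in> carrier_mat ?N q"
    and r: "vec_space.rank ?N C = q" and ZC: "Z = (\<lambda>x. complete_design J p x * C)"
    using Z unfolding designs_def by blast
  have "permute_rows ?\<kappa> C \<in> carrier_mat ?N q" using C by auto
  moreover have "vec_space.rank ?N (permute_rows ?\<kappa> C) = q"
    by (rule full_column_rank_permute_rows[OF C block_perm_permutes[OF \<tau>] r])
  moreover have "(\<lambda>x. permute_rows \<tau> (Z x)) = (\<lambda>x. complete_design J p x * permute_rows ?\<kappa> C)"
    unfolding ZC by (simp only: complete_design_permute_rows[OF \<tau> C])
  ultimately show ?thesis using q unfolding designs_def by blast
qed

section \<open>The reference ratio under permutations of the entries\<close>

lemma prob_vectors_permute_vec: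
  assumes "\<tau> permutes {..<J - 1}" and "\<pi> \<in> prob_vectors J"
  shows "permute_vec \<tau> \<pi> \<in> prob_vectors J"
  using assms sum_permute_vec[OF assms(1), of \<pi>]
    permute_vec_all_iff[OF assms(1), of \<pi> "\<lambda>u. 0 < u \<and> u < 1"]
  by (auto simp: prob_vectors_def)

lemma reference_ratio_carrier: "reference_ratio J \<pi> \<in> carrier_vec (J - 1)"
  by (simp add: reference_ratio_def)

text \<open>Each ratio involves only its own category and the reference one. The reference
  probability, being one minus the sum of the entries, does not change when the entries are
  permuted.\<close>

lemma reference_ratio_permute_vec:
  assumes \<tau>: "\<tau> permutes {..<J - 1}" and \<pi>: "\<pi> \<in> carrier_vec (J - 1)"
  shows "reference_ratio J (permute_vec \<tau> \<pi>) = permute_vec \<tau> (reference_ratio J \<pi>)"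
proof (rule eq_vecI)
  fix i assume "i < dim_vec (permute_vec \<tau> (reference_ratio J \<pi>))"
  then have i: "i < J - 1" by (simp add: permute_vec_def reference_ratio_def)
  moreover have "\<tau> i < J - 1" by (rule permutes_lessThan_less[OF \<tau> i])
  \<comment> \<open>So \<open>cat_prob\<close> returns a vector entry at both categories, not the
    complementary probability.\<close>
  moreover have "Suc i \<noteq> J" "Suc (\<tau> i) \<noteq> J" using calculation by auto
  moreover have "permute_vec \<tau> \<pi> $ i = \<pi> $ \<tau> i" using \<pi> i by (simp add: permute_vec_def)
  ultimately show "reference_ratio J (permute_vec \<tau> \<pi>) $ i =
      permute_vec \<tau> (reference_ratio J \<pi>) $ i"
    using sum_permute_vec[OF \<tau> \<pi>]
    by (simp add: reference_ratio_def cat_prob_def permute_vec_def[of \<tau> "Matrix.vec _ _"])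
qed (simp add: permute_vec_def reference_ratio_def)

lemma permute_vec_in_ratio_image_iff:
  assumes \<tau>: "\<tau> permutes {..<J - 1}" and y: "y \<in> carrier_vec (J - 1)"
  shows "permute_vec \<tau> y \<in> reference_ratio J ` prob_vectors J \<longleftrightarrow>
    y \<in> reference_ratio J ` prob_vectors J"
proof -
  \<comment> \<open>One direction for all permutations suffices: the converse applies it to the
    inverse of \<tau>.\<close>
  have closed: "permute_vec \<rho> z \<in> reference_ratio J ` prob_vectors J"
    if \<rho>: "\<rho> permutes {..<J - 1}" and z: "z \<in> reference_ratio J ` prob_vectors J" for \<rho> z
  proof -
    obtain \<pi> where \<pi>: "\<pi> \<in> prob_vectors J" "z = reference_ratio J \<pi>"
      using z by blast
    moreover have "\<pi> \<in> carrier_vec (J - 1)" using \<pi> by (simp add: prob_vectors_def)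
    ultimately show ?thesis
      using reference_ratio_permute_vec[OF \<rho>] prob_vectors_permute_vec[OF \<rho>]
      by (metis image_eqI)
  qed
  show ?thesis
    using closed[OF \<tau>] closed[OF permutes_inv[OF \<tau>]] permute_vec_inv[OF \<tau> y] by metis
qed

section \<open>From permutations of categories to permutations of indices\<close>

text \<open>Categories start at 1 and vector indices at 0, hence the shift.\<close>

definition index_perm :: "(nat \<Rightarrow> nat) \<Rightarrow> nat \<Rightarrow> nat" where
  "index_perm \<sigma> i = \<sigma> (i + 1) - 1"

text \<open>This turns the hypothesis on \<sigma> into one about the categories that index the
  vectors, and it reduces the count to that of all permutations of a set of \<open>J - 1\<close>
  elements.\<close>

lemma permutes_fixing_last:
  fixes J :: nat
  assumes "1 \<le> J"
  shows "\<sigma> permutes {1..J} \<and> \<sigma> J = J \<longleftrightarrow> \<sigma> permutes {1..J - 1}"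
proof
  assume \<sigma>: "\<sigma> permutes {1..J} \<and> \<sigma> J = J"
  show "\<sigma> permutes {1..J - 1}"
  proof (rule permutes_superset)
    show "\<sigma> permutes {1..J}" using \<sigma> ..
    fix x assume "x \<in> {1..J} - {1..J - 1}"
    then have "x = J" by auto
    then show "\<sigma> x = x" using \<sigma> by simp
  qed
next
  assume \<sigma>: "\<sigma> permutes {1..J - 1}"
  moreover have "\<sigma> J = J" by (rule permutes_not_in[OF \<sigma>]) (use assms in auto)
  ultimately show "\<sigma> permutes {1..J} \<and> \<sigma> J = J"
    using permutes_subset[OF \<sigma>, of "{1..J}"] by simp
qed

lemma index_perm_permutes:
  assumes \<sigma>: "\<sigma> permutes {1..n}"
  shows "index_perm \<sigma> permutes {..<n}"
proof -
  \<comment> \<open>The values are at least 1 here, so the natural-number subtraction in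
    \<open>index_perm\<close> is not truncated.\<close>
  have into: "\<rho> (i + 1) \<in> {1..n}" if "\<rho> permutes {1..n}" "i < n" for \<rho> i
    using permutes_in_image[OF that(1), of "i + 1"] that(2) by simp
  have into': "index_perm \<rho> i < n" if "\<rho> permutes {1..n}" "i < n" for \<rho> i
    using into[OF that] by (auto simp: index_perm_def)
  have canc: "index_perm \<rho> (index_perm \<rho>' i) = i"
    if "\<rho>' permutes {1..n}" "\<And>i. \<rho> (\<rho>' i) = i" "i < n" for \<rho> \<rho>' i
    using into[OF that(1,3)] that(2) by (simp add: index_perm_def)
  note inv = permutes_inv[OF \<sigma>] permutes_inverses[OF \<sigma>]
  have "bij_betw (index_perm \<sigma>) {..<n} {..<n}"
    by (rule bij_betw_byWitness[where f' = "index_perm (inv_into UNIV \<sigma>)"])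
      (use \<sigma> inv into' canc in auto)
  moreover have "index_perm \<sigma> i = i" if "i \<notin> {..<n}" for i
    using permutes_not_in[OF \<sigma>, of "i + 1"] that by (simp add: index_perm_def)
  ultimately show ?thesis by (rule bij_imp_permutes)
qed

lemma permute_probs_eq_permute_vec:
  assumes "\<sigma> permutes {1..J - 1}" and \<pi>: "\<pi> \<in> carrier_vec (J - 1)"
  shows "permute_probs J \<sigma> \<pi> = permute_vec (index_perm \<sigma>) \<pi>"
proof (rule eq_vecI)
  fix i assume "i < dim_vec (permute_vec (index_perm \<sigma>) \<pi>)"
  then have i: "i < J - 1" using \<pi> by (simp add: permute_vec_def)
  \<comment> \<open>The categories below \<open>J\<close> are mapped among themselves, so the
    reference probability never enters the permuted vector.\<close>
  then have "\<sigma> (i + 1) \<noteq> J" using permutes_in_image[OF assms(1), of "i + 1"] by auto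
  then show "permute_probs J \<sigma> \<pi> $ i = permute_vec (index_perm \<sigma>) \<pi> $ i"
    using i \<pi> by (simp add: permute_probs_def permute_vec_def cat_prob_def index_perm_def)
qed (use \<pi> in \<open>simp add: permute_probs_def permute_vec_def\<close>)

section \<open>Permuted models and stability\<close>

text \<open>Permuting the rows of \<open>Z\<close> permutes the right-hand side of the defining
  equation, and permuting the model permutes its left-hand side in the same way; the two
  permutations cancel. Both halves of stability are instances.\<close>

lemma permuted_model_permute_rows:
  assumes \<sigma>: "\<sigma> permutes {1..J - 1}" and Z: "\<And>x. dim_row (Z x) = J - 1"
  shows "models_equal X
    (permuted_model_of J X \<sigma> (reference_ratio J, F, \<lambda>x. permute_rows (index_perm \<sigma>) (Z x)))
    (model_of J X (reference_ratio J, F, Z))"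
proof -
  define \<tau> where "\<tau> = index_perm \<sigma>"
  have \<tau>: "\<tau> permutes {..<J - 1}" unfolding \<tau>_def by (rule index_perm_permutes[OF \<sigma>])
  have mult: "permute_rows \<tau> (Z x) *\<^sub>v \<beta> = permute_vec \<tau> (Z x *\<^sub>v \<beta>)"
    if "\<beta> \<in> carrier_vec (dim_col (Z x))" for x \<beta>
    using that \<tau> Z permute_rows_mult_vec[of \<tau> "Z x" \<beta>] by auto
  have carr: "Z x *\<^sub>v \<beta> \<in> carrier_vec (J - 1)" for x \<beta>
    using Z by (intro carrier_vecI) simp
  have map: "map_vec F (permute_vec \<tau> (Z x *\<^sub>v \<beta>)) = permute_vec \<tau> (map_vec F (Z x *\<^sub>v \<beta>))" for x \<beta>
    by (rule map_vec_permute_vec[OF \<tau> carr])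
  \<comment> \<open>The conditions on the parameter are invariant: one asks the same of every entry,
    the other is membership in an image closed under permutations of the entries.\<close>
  have "(\<forall>i < J - 1. (permute_rows \<tau> (Z x) *\<^sub>v \<beta>) $ i \<in> cdf_interval F) \<and>
        map_vec F (permute_rows \<tau> (Z x) *\<^sub>v \<beta>) \<in> reference_ratio J ` prob_vectors J \<longleftrightarrow>
      (\<forall>i < J - 1. (Z x *\<^sub>v \<beta>) $ i \<in> cdf_interval F) \<and>
        map_vec F (Z x *\<^sub>v \<beta>) \<in> reference_ratio J ` prob_vectors J"
    if "\<beta> \<in> carrier_vec (dim_col (Z x))" for x \<beta>
    using permute_vec_all_iff[OF \<tau> carr, of "\<lambda>u. u \<in> cdf_interval F"]
      permute_vec_in_ratio_image_iff[OF \<tau>, of "map_vec F (Z x *\<^sub>v \<beta>)"] carr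
    by (simp add: mult[OF that] map)
  then have par: "parameters J X (reference_ratio J, F, \<lambda>x. permute_rows \<tau> (Z x)) =
      parameters J X (reference_ratio J, F, Z)"
    unfolding parameters_def prod.case dim_permute_rows by blast
  \<comment> \<open>The conditions under \<open>THE\<close> are equivalent for each \<pi>, so both
    models select the same vector.\<close>
  have "\<pi> \<in> prob_vectors J \<and>
        reference_ratio J (permute_probs J \<sigma> \<pi>) = map_vec F (permute_rows \<tau> (Z x) *\<^sub>v \<beta>) \<longleftrightarrow>
      \<pi> \<in> prob_vectors J \<and> reference_ratio J \<pi> = map_vec F (Z x *\<^sub>v \<beta>)"
    if \<beta>: "\<beta> \<in> carrier_vec (dim_col (Z x))" for x \<beta> \<pi>
  proof (rule conj_cong[OF refl])
    assume "\<pi> \<in> prob_vectors J"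
    then have \<pi>: "\<pi> \<in> carrier_vec (J - 1)" by (simp add: prob_vectors_def)
    have "reference_ratio J (permute_probs J \<sigma> \<pi>) = permute_vec \<tau> (reference_ratio J \<pi>)"
      using permute_probs_eq_permute_vec[OF \<sigma> \<pi>] reference_ratio_permute_vec[OF \<tau> \<pi>]
      by (simp add: \<tau>_def)
    then show "reference_ratio J (permute_probs J \<sigma> \<pi>) = map_vec F (permute_rows \<tau> (Z x) *\<^sub>v \<beta>) \<longleftrightarrow>
        reference_ratio J \<pi> = map_vec F (Z x *\<^sub>v \<beta>)"
      using permute_vec_eq_iff[OF \<tau> reference_ratio_carrier, of "map_vec F (Z x *\<^sub>v \<beta>)"] carr
      by (simp add: mult[OF \<beta>] map)
  qed
  moreover have "\<beta> \<in> carrier_vec (dim_col (Z x))"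
    if "x \<in> X" "\<beta> \<in> parameters J X (reference_ratio J, F, Z)" for x \<beta>
    using that by (auto simp: parameters_def)
  ultimately show ?thesis
    by (simp add: models_equal_def permuted_model_of_def model_of_def par flip: \<tau>_def)
qed

theorem corollary3:
  fixes J p :: nat and X :: "real vec set"
  assumes "J \<ge> 3" and "p \<ge> 1" and "X \<subseteq> carrier_vec p" and "X \<noteq> {}"
  shows "card {\<sigma>. \<sigma> permutes {1..J} \<and> \<sigma> J = J} = fact (J - 1) \<and>
    (\<forall>\<sigma>. \<sigma> permutes {1..J} \<and> \<sigma> J = J \<longrightarrow> stable_under J X \<sigma> (reference_models J p))"
proof (intro conjI allI impI)
  have fixing: "\<sigma> permutes {1..J} \<and> \<sigma> J = J \<longleftrightarrow> \<sigma> permutes {1..J - 1}" for \<sigma>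
    by (rule permutes_fixing_last) (use assms(1) in simp)
  show "card {\<sigma>. \<sigma> permutes {1..J} \<and> \<sigma> J = J} = fact (J - 1)"
    unfolding fixing by (rule card_permutations) auto
  fix \<sigma> assume "\<sigma> permutes {1..J} \<and> \<sigma> J = J"
  then have \<sigma>: "\<sigma> permutes {1..J - 1}" unfolding fixing .
  let ?\<tau> = "index_perm \<sigma>"
  have \<tau>: "?\<tau> permutes {..<J - 1}" by (rule index_perm_permutes[OF \<sigma>])
  show "stable_under J X \<sigma> (reference_models J p)"
    unfolding stable_under_def
  proof (intro conjI ballI)
    fix s assume "s \<in> reference_models J p"
    then obtain F Z where s: "s = (reference_ratio J, F, Z)"
      and F: "F \<in> link_cdfs" and Z: "Z \<in> designs J p"
      unfolding reference_models_def by blast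
    \<comment> \<open>Undoing the permutation on the rows of \<open>Z\<close> makes \<open>Z\<close>
      itself the row permutation of a design \<open>Y\<close>, so that the permuted model of
      \<open>s\<close> is the ordinary model with design \<open>Y\<close>.\<close>
    define Y where "Y x = permute_rows (inv_into UNIV ?\<tau>) (Z x)" for x
    have Y: "Y \<in> designs J p"
      unfolding Y_def by (rule designs_permute_rows[OF permutes_inv[OF \<tau>] Z])
    have ZY: "Z = (\<lambda>x. permute_rows ?\<tau> (Y x))"
      using \<tau> designs_dim_row[OF Z] by (auto simp: Y_def permute_rows_inv)
    have "models_equal X (permuted_model_of J X \<sigma> s) (model_of J X (reference_ratio J, F, Y))"
      unfolding s ZY by (rule permuted_model_permute_rows[OF \<sigma> designs_dim_row[OF Y]])
    moreover have "(reference_ratio J, F, Y) \<in> reference_models J p"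
      using F Y unfolding reference_models_def by blast
    ultimately show "\<exists>t \<in> reference_models J p.
        models_equal X (permuted_model_of J X \<sigma> s) (model_of J X t)" by blast
  next
    fix t assume "t \<in> reference_models J p"
    then obtain F Z where t: "t = (reference_ratio J, F, Z)"
      and F: "F \<in> link_cdfs" and Z: "Z \<in> designs J p"
      unfolding reference_models_def by blast
    \<comment> \<open>Conversely, a given model arises by permuting the one whose design has its
      rows permuted.\<close>
    let ?s = "(reference_ratio J, F, \<lambda>x. permute_rows ?\<tau> (Z x))"
    have "models_equal X (permuted_model_of J X \<sigma> ?s) (model_of J X t)"
      unfolding t by (rule permuted_model_permute_rows[OF \<sigma> designs_dim_row[OF Z]])
    then have "models_equal X (model_of J X t) (permuted_model_of J X \<sigma> ?s)"
      by (auto simp: models_equal_def)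
    moreover have "?s \<in> reference_models J p"
      using F designs_permute_rows[OF \<tau> Z] unfolding reference_models_def by blast
    ultimately show "\<exists>s \<in> reference_models J p.
        models_equal X (model_of J X t) (permuted_model_of J X \<sigma> s)" by blast
  qed
qed

end
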